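(* Let $\mathcal{G}=(\mathcal{V},\mathcal{E})$ be a directed graph with $\mathcal{V}=\{1,\ldots,n\}$, let $\{G_{ij}\}_{(i,j)\in\mathcal{E}}$ be a collection of matrices in $GL(d,\mathbb{R})$ that is transitively consistent for $\mathcal{G}$, and let $\{G_i\}_{i\in\mathcal{V}}$ be a collection of matrices in $GL(d,\mathbb{R})$. Let $Z=Z(\mathcal{G},\{G_{ij}\}_{(i,j)\in\mathcal{E}})$ and let $L$ be the graph Laplacian matrix of $\mathcal{G}$. Consider the two conditions: (A) $G_{ij}=G_i^{-1}G_j$ for all $(i,j)\in\mathcal{E}$; (B) $\mathrm{im}\bigl(\mathrm{diag}(G_1,G_2,\ldots,G_n)V\bigr)=\ker(L\otimes I_d)$ for any matrix $V$ whose columns form a basis for $\ker(Z)$. Then (A) implies (B). If moreover $\mathcal{G}$ is quasi-strongly connected, then (A) holds if and only if (B) holds, and in this case (B) is equivalent to $$\mathrm{im}\bigl(U_1(\{G_i\}_{i\in\mathcal{V}})\bigr)=\ker(Z).$$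
   Context: $\mathcal{G}=(\mathcal{V},\mathcal{E})$ is a directed graph with node set $\mathcal{V}=\{1,\ldots,n\}$ and edge set $\mathcal{E}\subset\mathcal{V}\times\mathcal{V}$. The graph is quasi-strongly connected (QSC) if it contains a center, i.e. a node to which there is a directed path from any other node; a directed path is a finite sequence of unique nodes such that any pair of consecutive nodes in the sequence is an edge in $\mathcal{E}$. The adjacency matrix $A$ has $A_{ij}=1$ if $(i,j)\in\mathcal{E}$ and $0$ otherwise; the Laplacian is $L=\mathrm{diag}(A\,1_n)-A$ with $1_n$ the all-ones vector. $Z(\mathcal{G},\{G_{ij}\})=\mathrm{diag}(A\,1_n)\otimes I_d-W$, where $W\in\mathbb{R}^{nd\times nd}$ is the block matrix whose $(i,j)$ block of size $d\times d$ is $G_{ij}$ if $(i,j)\in\mathcal{E}$ and $0$ otherwise. $\mathrm{diag}(G_1,\ldots,G_n)$ is the block diagonal matrix with blocks $G_i$. $U_1(\{G_i\}_{i\in\mathcal{V}})=[G_1^{-T}\ \cdots\ G_n^{-T}]^T\in\mathbb{R}^{nd\times d}$, i.e. the vertical stack of $G_1^{-1},\ldots,G_n^{-1}$. Transitive consistency: a collection $\{G_{ij}\}_{(i,j)\in\mathcal{V}\times\mathcal{V}}$ in $GL(d,\mathbb{R})$ is transitively consistent for the complete graph if $G_{ik}=G_{ij}G_{jk}$ for all $i,j,k$. A collection $\{G_{ij}\}_{(i,j)\in\mathcal{E}}$ in $GL(d,\mathbb{R})$ is transitively consistent for $\mathcal{G}$ if it can be extended to a collection $\{G_{ij}\}_{(i,j)\in\mathcal{V}\times\mathcal{V}}$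 in $GL(d,\mathbb{R})$ that is transitively consistent for the complete graph. *)

theory Defs
  imports
    "Jordan_Normal_Form.Matrix_Kernel"
    "Graph_Theory.Pair_Digraph"
begin

text \<open>
  Matrices and vectors are indexed from 0, so the vertex set of a graph on \<open>n\<close> vertices
  is \<open>{..<n}\<close> rather than \<open>{1..n}\<close>. The families \<open>{G\<^sub>i}\<close> and \<open>{G\<^sub>i\<^sub>j}\<close> are total functions on
  indices; only their values on vertices, respectively edges, are ever constrained or used.
\<close>

definition digraph_on :: "nat \<Rightarrow> nat pair_pre_digraph \<Rightarrow> bool" where
  "digraph_on n G \<longleftrightarrow> pair_wf_digraph G \<and> pverts G = {..<n}"

text \<open>\<open>apath\<close> is a walk that visits pairwise distinct vertices. Paths lead towards the center.\<close>

definition is_center :: "'a pair_pre_digraph \<Rightarrow> 'a \<Rightarrow> bool" where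
  "is_center G c \<longleftrightarrow>
     c \<in> pverts G \<and> (\<forall>v \<in> pverts G - {c}. \<exists>p. pre_digraph.apath (with_proj G) v p c)"

definition quasi_strongly_connected :: "'a pair_pre_digraph \<Rightarrow> bool" where
  "quasi_strongly_connected G \<longleftrightarrow> (\<exists>c. is_center G c)"

definition GL :: "nat \<Rightarrow> real mat set" where
  "GL d = Units (ring_mat TYPE(real) d ())"

definition GL_inv :: "nat \<Rightarrow> real mat \<Rightarrow> real mat" where
  "GL_inv d M = inv\<^bsub>ring_mat TYPE(real) d ()\<^esub> M"

definition adjacency_mat :: "nat \<Rightarrow> nat pair_pre_digraph \<Rightarrow> real mat" where
  "adjacency_mat n G = mat n n (\<lambda>(i, j). if (i, j) \<in> parcs G then 1 else 0)"

definition ones_vec :: "nat \<Rightarrow> real vec" where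
  "ones_vec n = vec n (\<lambda>_. 1)"

definition degree_mat :: "nat \<Rightarrow> nat pair_pre_digraph \<Rightarrow> real mat" where
  "degree_mat n G = mat_diag n (\<lambda>i. (adjacency_mat n G *\<^sub>v ones_vec n) $ i)"

definition laplacian_mat :: "nat \<Rightarrow> nat pair_pre_digraph \<Rightarrow> real mat" where
  "laplacian_mat n G = degree_mat n G - adjacency_mat n G"

definition kronecker :: "real mat \<Rightarrow> real mat \<Rightarrow> real mat" (infixl \<open>\<otimes>\<^sub>K\<close> 70) where
  "A \<otimes>\<^sub>K B = mat (dim_row A * dim_row B) (dim_col A * dim_col B)
     (\<lambda>(r, c). A $$ (r div dim_row B, c div dim_col B) * B $$ (r mod dim_row B, c mod dim_col B))"

text \<open>The \<open>p \<times> q\<close> block matrix whose \<open>(i, j)\<close> block is the \<open>d \<times> d\<close> matrix \<open>B i j\<close>.\<close>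

definition block_mat :: "nat \<Rightarrow> nat \<Rightarrow> nat \<Rightarrow> (nat \<Rightarrow> nat \<Rightarrow> real mat) \<Rightarrow> real mat" where
  "block_mat p q d B = mat (p * d) (q * d) (\<lambda>(r, c). B (r div d) (c div d) $$ (r mod d, c mod d))"

definition W_mat :: "nat \<Rightarrow> nat \<Rightarrow> nat pair_pre_digraph \<Rightarrow> (nat \<Rightarrow> nat \<Rightarrow> real mat) \<Rightarrow> real mat" where
  "W_mat n d G Gij = block_mat n n d (\<lambda>i j. if (i, j) \<in> parcs G then Gij i j else 0\<^sub>m d d)"

definition Z_mat :: "nat \<Rightarrow> nat \<Rightarrow> nat pair_pre_digraph \<Rightarrow> (nat \<Rightarrow> nat \<Rightarrow> real mat) \<Rightarrow> real mat" where
  "Z_mat n d G Gij = degree_mat n G \<otimes>\<^sub>K 1\<^sub>m d - W_mat n d G Gij"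

definition diag_mat_family :: "nat \<Rightarrow> (nat \<Rightarrow> real mat) \<Rightarrow> real mat" where
  "diag_mat_family n Gi = diag_block_mat (map Gi [0..<n])"

definition U1_mat :: "nat \<Rightarrow> nat \<Rightarrow> (nat \<Rightarrow> real mat) \<Rightarrow> real mat" where
  "U1_mat n d Gi = block_mat n 1 d (\<lambda>i _. GL_inv d (Gi i))"

definition mat_image :: "real mat \<Rightarrow> real vec set" where
  "mat_image M = (\<lambda>x. M *\<^sub>v x) ` carrier_vec (dim_col M)"

text \<open>
  The number of columns of \<open>V\<close> is not fixed in advance, and a basis is a set in the library;
  distinctness rules out repeated columns.
\<close>

definition columns_form_kernel_basis :: "real mat \<Rightarrow> real mat \<Rightarrow> bool" where
  "columns_form_kernel_basis V M \<longleftrightarrow>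
     dim_row V = dim_col M \<and> distinct (cols V) \<and> kernel.basis (dim_col M) M (set (cols V))"

definition transitively_consistent_complete ::
    "nat \<Rightarrow> nat \<Rightarrow> (nat \<Rightarrow> nat \<Rightarrow> real mat) \<Rightarrow> bool" where
  "transitively_consistent_complete n d H \<longleftrightarrow>
     (\<forall>i<n. \<forall>j<n. H i j \<in> GL d) \<and>
     (\<forall>i<n. \<forall>j<n. \<forall>k<n. H i k = H i j * H j k)"

definition transitively_consistent ::
    "nat \<Rightarrow> nat \<Rightarrow> nat pair_pre_digraph \<Rightarrow> (nat \<Rightarrow> nat \<Rightarrow> real mat) \<Rightarrow> bool" where
  "transitively_consistent n d G Gij \<longleftrightarrow>
     (\<forall>(i, j) \<in> parcs G. Gij i j \<in> GL d) \<and>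
     (\<exists>H. transitively_consistent_complete n d H \<and> (\<forall>(i, j) \<in> parcs G. H i j = Gij i j))"

definition edges_factor ::
    "nat \<Rightarrow> nat pair_pre_digraph \<Rightarrow> (nat \<Rightarrow> nat \<Rightarrow> real mat) \<Rightarrow> (nat \<Rightarrow> real mat) \<Rightarrow> bool" where
  "edges_factor d G Gij Gi \<longleftrightarrow> (\<forall>(i, j) \<in> parcs G. Gij i j = GL_inv d (Gi i) * Gi j)"

definition diag_maps_kernel ::
    "nat \<Rightarrow> nat \<Rightarrow> nat pair_pre_digraph \<Rightarrow> (nat \<Rightarrow> nat \<Rightarrow> real mat) \<Rightarrow> (nat \<Rightarrow> real mat) \<Rightarrow> bool" where
  "diag_maps_kernel n d G Gij Gi \<longleftrightarrow>
     (\<forall>V. columns_form_kernel_basis V (Z_mat n d G Gij) \<longrightarrow>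
        mat_image (diag_mat_family n Gi * V) = mat_kernel (laplacian_mat n G \<otimes>\<^sub>K 1\<^sub>m d))"

end

theory Submission
  imports Defs
begin

text \<open>
  Write \<open>x\<^sub>i\<close> for the \<open>i\<close>-th block of length \<open>d\<close> of a vector \<open>x\<close>, \<open>D\<close> for the block diagonal matrix of
  the \<open>G\<^sub>i\<close>, and \<open>L\<close> for the Laplacian. Block \<open>i\<close> of \<open>Z x\<close> is the sum of \<open>x\<^sub>i - G\<^sub>i\<^sub>j x\<^sub>j\<close> over the
  edges \<open>(i, j)\<close>, and \<open>L \<otimes> I\<close> is the matrix \<open>Z\<close> of the same graph with all edge matrices equal to
  the identity. The columns of any admissible \<open>V\<close> span \<open>ker Z\<close>, so condition (B) says that \<open>D\<close> maps
  \<open>ker Z\<close> onto \<open>ker (L \<otimes> I)\<close> (\<open>diag_maps_kernel_iff\<close>).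

  If (A) holds, then \<open>G\<^sub>i (x\<^sub>i - G\<^sub>i\<^sub>j x\<^sub>j) = G\<^sub>i x\<^sub>i - G\<^sub>j x\<^sub>j\<close>, that is, \<open>(L \<otimes> I) D = D Z\<close>. As \<open>D\<close> is
  invertible, it carries one kernel onto the other, which is (B)
  (\<open>edges_factor_imp_diag_maps_kernel\<close>).

  If the graph has a center, a maximum principle shows that \<open>ker (L \<otimes> I)\<close> consists of the vectors
  whose blocks are all equal (\<open>laplacian_kernel_consensus\<close>). These vectors are exactly the image under
  \<open>D\<close> of \<open>im U\<^sub>1\<close>, so by injectivity of \<open>D\<close> condition (B) is equivalent to \<open>im U\<^sub>1 = ker Z\<close>
  (\<open>diag_maps_kernel_iff_image_U1\<close>).

  For the converse from (B) to (A), transitive consistency provides some family \<open>K\<^sub>i\<close> that satisfies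
  (A), hence (B). So \<open>im U\<^sub>1\<close> is the same for \<open>G\<^sub>i\<close> and \<open>K\<^sub>i\<close>, both being \<open>ker Z\<close>. This forces
  \<open>K\<^sub>i G\<^sub>i\<inverse>\<close> to be independent of \<open>i\<close>, whence \<open>G\<^sub>i\<inverse> G\<^sub>j = K\<^sub>i\<inverse> K\<^sub>j\<close> (\<open>image_U1_eq_imp_same_quotients\<close>).
\<close>

section \<open>Blocks of vectors and block matrices\<close>

definition vec_block :: "nat \<Rightarrow> real vec \<Rightarrow> nat \<Rightarrow> real vec" where
  "vec_block d x i = vec d (\<lambda>k. x $ (i * d + k))"

lemma vec_block_carrier [simp]: "vec_block d x i \<in> carrier_vec d"
  by (simp add: vec_block_def)

lemma block_index_less: "i < n \<Longrightarrow> k < d \<Longrightarrow> i * d + k < n * (d::nat)"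
  using mult_le_mono1[of "Suc i" n d] by simp

lemma block_indices:
  fixes r n d :: nat
  assumes "r < n * d"
  shows "r div d < n" "r mod d < d"
proof -
  have "d > 0" using assms by (cases d) auto
  then show "r div d < n" "r mod d < d"
    using assms by (simp_all add: less_mult_imp_div_less)
qed

lemma vec_eq_blockwise:
  assumes "x \<in> carrier_vec (n * d)" "y \<in> carrier_vec (n * d)"
    and "\<And>i. i < n \<Longrightarrow> vec_block d x i = vec_block d y i"
  shows "x = y"
proof (rule eq_vecI)
  fix r assume "r < dim_vec y"
  then have r: "r < n * d" using assms(2) by simp
  from assms(3)[OF block_indices(1)[OF r]]
  have "vec_block d x (r div d) $ (r mod d) = vec_block d y (r div d) $ (r mod d)" by simp
  then show "x $ r = y $ r" using block_indices(2)[OF r] by (simp add: vec_block_def)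
qed (use assms in auto)

lemma vec_block_zero: "i < n \<Longrightarrow> vec_block d (0\<^sub>v (n * d)) i = 0\<^sub>v d"
  by (rule eq_vecI) (auto simp: vec_block_def block_index_less)

lemma block_mat_carrier [simp]: "block_mat p q d B \<in> carrier_mat (p * d) (q * d)"
  by (simp add: block_mat_def)

text \<open>
  A column index \<open>c\<close> is split as \<open>j * d + l\<close>, which matches the \<open>div\<close> and \<open>mod\<close> in the indexing of
  block matrices.
\<close>
lemma sum_over_blocks:
  fixes f :: "nat \<Rightarrow> real"
  shows "(\<Sum>c\<in>{0..<q * d}. f c) = (\<Sum>j<q. \<Sum>l\<in>{0..<d}. f (j * d + l))"
proof -
  have "(\<Sum>c\<in>{0..<q * d}. f c) = (\<Sum>j<q. sum f {j * d..<j * d + d})"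
    by (simp add: sum.nat_group atLeast0LessThan)
  also have "\<dots> = (\<Sum>j<q. \<Sum>l\<in>{0..<d}. f (j * d + l))"
  proof (rule sum.cong[OF refl])
    fix j
    show "sum f {j * d..<j * d + d} = (\<Sum>l\<in>{0..<d}. f (j * d + l))"
      using sum.shift_bounds_nat_ivl[of f 0 "j * d" d] by (simp add: add.commute)
  qed
  finally show ?thesis .
qed

lemma vec_block_block_mat_mult:
  assumes "x \<in> carrier_vec (q * d)" "i < p" "k < d"
    and B: "\<And>j. j < q \<Longrightarrow> B i j \<in> carrier_mat d d"
  shows "vec_block d (block_mat p q d B *\<^sub>v x) i $ k
    = (\<Sum>j<q. (B i j *\<^sub>v vec_block d x j) $ k)"
proof -
  have r: "i * d + k < p * d" using assms by (simp add: block_index_less)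
  have "vec_block d (block_mat p q d B *\<^sub>v x) i $ k
      = (\<Sum>c\<in>{0..<q * d}. B i (c div d) $$ (k, c mod d) * x $ c)"
    using assms(1,3) r by (simp add: vec_block_def block_mat_def scalar_prod_def)
  also have "\<dots> = (\<Sum>j<q. \<Sum>l\<in>{0..<d}. B i j $$ (k, l) * x $ (j * d + l))"
    unfolding sum_over_blocks by simp
  also have "\<dots> = (\<Sum>j<q. (B i j *\<^sub>v vec_block d x j) $ k)"
    using carrier_matD[OF B] assms(3)
    by (intro sum.cong) (simp_all add: scalar_prod_def vec_block_def)
  finally show ?thesis .
qed

lemma vec_block_block_diagonal_mult:
  assumes F: "\<And>i. i < n \<Longrightarrow> F i \<in> carrier_mat d d"
    and x: "x \<in> carrier_vec (n * d)" and i: "i < n"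
  shows "vec_block d (block_mat n n d (\<lambda>i j. if i = j then F i else 0\<^sub>m d d) *\<^sub>v x) i
    = F i *\<^sub>v vec_block d x i"
proof (rule eq_vecI)
  fix k assume "k < dim_vec (F i *\<^sub>v vec_block d x i)"
  then have k: "k < d" using F[OF i] by simp
  let ?B = "\<lambda>i j. if i = j then F i else 0\<^sub>m d d"
  have "vec_block d (block_mat n n d ?B *\<^sub>v x) i $ k = (\<Sum>j<n. (?B i j *\<^sub>v vec_block d x j) $ k)"
    using F i x k by (simp add: vec_block_block_mat_mult)
  also have "\<dots> = (\<Sum>j<n. if i = j then (F i *\<^sub>v vec_block d x i) $ k else 0)"
    using k by (intro sum.cong) auto
  also have "\<dots> = (F i *\<^sub>v vec_block d x i) $ k" using i by simp
  finally show "vec_block d (block_mat n n d ?B *\<^sub>v x) i $ k = (F i *\<^sub>v vec_block d x i) $ k" .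
qed (use F[OF i] in \<open>simp add: vec_block_def\<close>)

text \<open>
  \<open>diag_block_mat\<close> is recursive and pads with zero blocks; the explicit indexing by \<open>div\<close> and \<open>mod\<close>
  makes its action on blocks of a vector computable. The induction peels off the last block, since
  the first \<open>n\<close> blocks then keep their indices.
\<close>
lemma diag_mat_family_block_mat:
  assumes "\<And>i. i < n \<Longrightarrow> F i \<in> carrier_mat d d"
  shows "diag_mat_family n F = block_mat n n d (\<lambda>i j. if i = j then F i else 0\<^sub>m d d)"
  using assms
proof (induction n)
  case 0
  then show ?case by (auto simp: diag_mat_family_def block_mat_def)
next
  case (Suc n)
  let ?B = "\<lambda>i j. if i = j then F i else 0\<^sub>m d d"
  have IH: "diag_mat_family n F = block_mat n n d ?B" using Suc by simp
  have F: "F n \<in> carrier_mat d d" using Suc by simp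
  have "diag_mat_family (Suc n) F = four_block_mat (block_mat n n d ?B)
      (0\<^sub>m (n * d) d) (0\<^sub>m d (n * d)) (F n)"
    using IH F by (simp add: diag_mat_family_def diag_block_mat_last Let_def block_mat_def)
  also have "\<dots> = block_mat (Suc n) (Suc n) d ?B"
  proof (rule eq_matI)
    fix r c assume "r < dim_row (block_mat (Suc n) (Suc n) d ?B)"
      and "c < dim_col (block_mat (Suc n) (Suc n) d ?B)"
    then have r: "r < Suc n * d" and c: "c < Suc n * d" by (simp_all add: block_mat_def)
    \<comment> \<open>Indices past the first \<open>n\<close> blocks lie in block \<open>n\<close>, the one that is appended.\<close>
    have last: "s div d = n \<and> s mod d = s - n * d" if "\<not> s < n * d" "s < Suc n * d" for s
    proof -
      have "s - n * d < d" "s = n * d + (s - n * d)" using that by auto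
      then show ?thesis
        by (metis div_mult_self3 div_less add.right_neutral mod_less mod_mult_self3 less_nat_zero_code)
    qed
    show "four_block_mat (block_mat n n d ?B) (0\<^sub>m (n * d) d) (0\<^sub>m d (n * d)) (F n) $$ (r, c)
        = block_mat (Suc n) (Suc n) d ?B $$ (r, c)"
      using r c F last[of r] last[of c] block_indices[of r n d] block_indices[of c n d] block_indices[of r "Suc n" d] block_indices[of c "Suc n" d]
      by (cases "r < n * d"; cases "c < n * d") (auto simp: block_mat_def)
  qed (use F in \<open>auto simp: block_mat_def\<close>)
  finally show ?case .
qed

lemma diag_mat_family_carrier:
  assumes "\<And>i. i < n \<Longrightarrow> F i \<in> carrier_mat d d"
  shows "diag_mat_family n F \<in> carrier_mat (n * d) (n * d)"
  using diag_mat_family_block_mat[of n F d] assms by simp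

lemma vec_block_diag_mat_family:
  assumes F: "\<And>i. i < n \<Longrightarrow> F i \<in> carrier_mat d d"
    and x: "x \<in> carrier_vec (n * d)" and i: "i < n"
  shows "vec_block d (diag_mat_family n F *\<^sub>v x) i = F i *\<^sub>v vec_block d x i"
  using vec_block_block_diagonal_mult[of n F d, OF F x i] diag_mat_family_block_mat[of n F d] F
  by simp

section \<open>The matrix Z and the Laplacian\<close>
lemma degree_kronecker_block_mat:
  "degree_mat n G \<otimes>\<^sub>K 1\<^sub>m d
    = block_mat n n d (\<lambda>i j. if i = j then (\<Sum>j<n. if (i, j) \<in> parcs G then 1 else 0) \<cdot>\<^sub>m 1\<^sub>m d else 0\<^sub>m d d)"
  by (rule eq_matI)
    (auto simp: kronecker_def degree_mat_def block_mat_def mat_diag_def adjacency_mat_def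
      ones_vec_def scalar_prod_def block_indices atLeast0LessThan)

lemma scaled_identity_mult_vec_index:
  fixes a :: real
  assumes "y \<in> carrier_vec d" "k < d"
  shows "(a \<cdot>\<^sub>m 1\<^sub>m d *\<^sub>v y) $ k = a * y $ k"
proof -
  have "row (a \<cdot>\<^sub>m 1\<^sub>m d) k = a \<cdot>\<^sub>v unit_vec d k" using assms(2) by (intro eq_vecI) auto
  then show ?thesis using assms by simp
qed

text \<open>
  The Laplacian is the special case of trivial edge matrices, so every fact about \<open>Z\<close> also applies
  to \<open>L \<otimes> I\<close>.
\<close>
lemma laplacian_kronecker_eq_Z_mat:
  "laplacian_mat n G \<otimes>\<^sub>K 1\<^sub>m d = Z_mat n d G (\<lambda>_ _. 1\<^sub>m d)"
  by (rule eq_matI)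
    (auto simp: Z_mat_def W_mat_def laplacian_mat_def kronecker_def degree_mat_def block_mat_def
      mat_diag_def adjacency_mat_def block_indices)

lemma Z_mat_carrier [simp]: "Z_mat n d G B \<in> carrier_mat (n * d) (n * d)"
  by (auto simp: Z_mat_def W_mat_def intro!: minus_carrier_mat)

text \<open>
  The disagreement form of \<open>Z\<close>: the degree counts the edges leaving \<open>i\<close>, so one copy of the block
  \<open>x\<^sub>i\<close> can be paired with the term \<open>G\<^sub>i\<^sub>j x\<^sub>j\<close> of each such edge. The formula is stated entrywise in
  order to use sums of real numbers in place of sums of vectors.
\<close>
lemma vec_block_Z_mat:
  assumes x: "x \<in> carrier_vec (n * d)" and i: "i < n" and k: "k < d"
    and B: "\<And>j. (i, j) \<in> parcs G \<Longrightarrow> B i j \<in> carrier_mat d d"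
  shows "vec_block d (Z_mat n d G B *\<^sub>v x) i $ k
    = (\<Sum>j<n. if (i, j) \<in> parcs G then vec_block d x i $ k - (B i j *\<^sub>v vec_block d x j) $ k else 0)"
proof -
  let ?deg = "\<Sum>j<n. if (i, j) \<in> parcs G then 1 else (0::real)"
  have r: "i * d + k < n * d" using i k by (simp add: block_index_less)
  have D: "vec_block d (degree_mat n G \<otimes>\<^sub>K 1\<^sub>m d *\<^sub>v x) i $ k = ?deg * vec_block d x i $ k"
  proof -
    have "vec_block d (degree_mat n G \<otimes>\<^sub>K 1\<^sub>m d *\<^sub>v x) i = ?deg \<cdot>\<^sub>m 1\<^sub>m d *\<^sub>v vec_block d x i"
      unfolding degree_kronecker_block_mat
      using x i by (subst vec_block_block_diagonal_mult[
            where F = "\<lambda>i. (\<Sum>j<n. if (i, j) \<in> parcs G then 1 else 0) \<cdot>\<^sub>m 1\<^sub>m d"]) auto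
    then show ?thesis using scaled_identity_mult_vec_index[OF vec_block_carrier k] by simp
  qed
  have W: "vec_block d (W_mat n d G B *\<^sub>v x) i $ k
       = (\<Sum>j<n. if (i, j) \<in> parcs G then (B i j *\<^sub>v vec_block d x j) $ k else 0)"
    unfolding W_mat_def using x i k B
    by (subst vec_block_block_mat_mult) (auto intro!: sum.cong)
  have "vec_block d (Z_mat n d G B *\<^sub>v x) i $ k
      = vec_block d (degree_mat n G \<otimes>\<^sub>K 1\<^sub>m d *\<^sub>v x) i $ k - vec_block d (W_mat n d G B *\<^sub>v x) i $ k"
  proof -
    have "Z_mat n d G B *\<^sub>v x = degree_mat n G \<otimes>\<^sub>K 1\<^sub>m d *\<^sub>v x - W_mat n d G B *\<^sub>v x"
      unfolding Z_mat_def using x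
      by (intro minus_mult_distrib_mat_vec[where nr = "n * d" and nc = "n * d"]) (auto simp: W_mat_def degree_kronecker_block_mat)
    then show ?thesis using k r by (simp add: vec_block_def W_mat_def block_mat_def)
  qed
  also have "\<dots> = (\<Sum>j<n. if (i, j) \<in> parcs G then vec_block d x i $ k - (B i j *\<^sub>v vec_block d x j) $ k else 0)"
    unfolding D W sum_distrib_right sum_subtractf[symmetric] by (intro sum.cong) auto
  finally show ?thesis .
qed

section \<open>Invertible matrices\<close>
lemma GL_carrier: "M \<in> GL d \<Longrightarrow> M \<in> carrier_mat d d"
  by (auto simp: GL_def Units_def ring_mat_simps)

lemma GL_inv_carrier: "M \<in> GL d \<Longrightarrow> GL_inv d M \<in> carrier_mat d d"
  and GL_inv_left: "M \<in> GL d \<Longrightarrow> GL_inv d M * M = 1\<^sub>m d"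
  and GL_inv_right: "M \<in> GL d \<Longrightarrow> M * GL_inv d M = 1\<^sub>m d"
proof -
  interpret ring "ring_mat TYPE(real) d ()" by (rule ring_mat)
  assume "M \<in> GL d"
  then show "GL_inv d M \<in> carrier_mat d d" "GL_inv d M * M = 1\<^sub>m d" "M * GL_inv d M = 1\<^sub>m d"
    using Units_inv_closed Units_l_inv Units_r_inv
    by (auto simp: GL_def GL_inv_def ring_mat_simps)
qed

lemma GL_inv_mult_vec_cancel:
  assumes "M \<in> GL d" "v \<in> carrier_vec d"
  shows "GL_inv d M *\<^sub>v (M *\<^sub>v v) = v" "M *\<^sub>v (GL_inv d M *\<^sub>v v) = v"
  using assms by (simp_all add: GL_carrier GL_inv_carrier GL_inv_left GL_inv_right
      flip: assoc_mult_mat_vec[of _ d d _ d])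

lemma mat_eq_by_action:
  fixes A B :: "real mat"
  assumes "A \<in> carrier_mat m n" "B \<in> carrier_mat m n"
    and "\<And>v. v \<in> carrier_vec n \<Longrightarrow> A *\<^sub>v v = B *\<^sub>v v"
  shows "A = B"
proof (rule eq_matI)
  fix i j assume "i < dim_row B" "j < dim_col B"
  moreover have "(A *\<^sub>v unit_vec n j) $ i = (B *\<^sub>v unit_vec n j) $ i"
    using assms(3)[of "unit_vec n j"] by simp
  ultimately show "A $$ (i, j) = B $$ (i, j)" using assms(1,2) by simp
qed (use assms in auto)

section \<open>Condition (B) without bases\<close>

text \<open>
  The span of a basis in the kernel agrees with its span in the ambient space, and the latter is the
  column space of \<open>V\<close>.
\<close>
lemma mat_image_kernel_basis:
  assumes Z: "Z \<in> carrier_mat m n" and V: "columns_form_kernel_basis V Z"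
  shows "mat_image V = mat_kernel Z"
proof -
  have dim: "V *\<^sub>v x \<in> carrier_vec (dim_row V)" for x by (rule carrier_vecI) simp
  interpret kernel m n Z by unfold_locales (rule Z)
  have Vc: "V \<in> carrier_mat n (dim_col V)" and b: "basis (set (cols V))"
    using V Z by (auto simp: columns_form_kernel_basis_def)
  have "set (cols V) \<subseteq> mat_kernel Z" "span (set (cols V)) = mat_kernel Z"
    using b by (auto simp: Ker.basis_def)
  then have "NC.col_space V = mat_kernel Z"
    using span_same by (simp add: NC.col_space_def)
  moreover have "NC.col_space V = mat_image V"
    unfolding NC.col_space_eq[OF Vc] mat_image_def image_def using dim by blast
  ultimately show ?thesis by simp
qed

text \<open>
  Without this, condition (B), which quantifies over all \<open>V\<close>, could hold vacuously.
\<close>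
lemma columns_form_kernel_basis_exists:
  fixes Z :: "real mat"
  shows "\<exists>V. columns_form_kernel_basis V Z"
proof -
  have Z: "Z \<in> carrier_mat (dim_row Z) (dim_col Z)" by simp
  interpret kernel "dim_row Z" "dim_col Z" Z by unfold_locales (rule Z)
  obtain B where B: "finite B" "basis B" using kernel_basis_exists[OF Z] by blast
  obtain vs where vs: "set vs = B" "distinct vs" using finite_distinct_list[OF B(1)] by blast
  have "set vs \<subseteq> carrier_vec (dim_col Z)"
    using B(2) vs mat_kernel_carrier[OF Z] by (auto simp: Ker.basis_def)
  then have "columns_form_kernel_basis (mat_of_cols (dim_col Z) vs) Z"
    using vs B by (simp add: columns_form_kernel_basis_def)
  then show ?thesis ..
qed

lemma mat_image_mult:
  assumes "A \<in> carrier_mat m n" "B \<in> carrier_mat n k"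
  shows "mat_image (A * B) = (\<lambda>x. A *\<^sub>v x) ` mat_image B"
  using assms by (auto simp: mat_image_def image_image intro!: image_cong)

text \<open>
  For each admissible \<open>V\<close>, \<open>im (D V) = D (im V) = D (ker Z)\<close>.
\<close>
lemma diag_maps_kernel_iff:
  assumes F: "\<And>i. i < n \<Longrightarrow> F i \<in> carrier_mat d d"
  shows "diag_maps_kernel n d G B F \<longleftrightarrow>
    (\<lambda>x. diag_mat_family n F *\<^sub>v x) ` mat_kernel (Z_mat n d G B)
      = mat_kernel (laplacian_mat n G \<otimes>\<^sub>K 1\<^sub>m d)"
proof -
  let ?D = "diag_mat_family n F" and ?Z = "Z_mat n d G B"
  have Z: "?Z \<in> carrier_mat (n * d) (n * d)" by simp
  have *: "mat_image (?D * V) = (\<lambda>x. ?D *\<^sub>v x) ` mat_kernel ?Z"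
    if V: "columns_form_kernel_basis V ?Z" for V
  proof -
    have "V \<in> carrier_mat (n * d) (dim_col V)"
      using V Z by (auto simp: columns_form_kernel_basis_def)
    from mat_image_mult[OF diag_mat_family_carrier[OF F] this] show ?thesis
      by (simp add: mat_image_kernel_basis[OF Z V])
  qed
  then show ?thesis
    using columns_form_kernel_basis_exists[of ?Z] by (auto simp: diag_maps_kernel_def)
qed

lemma diag_mat_family_inverse:
  assumes F: "\<forall>i<n. F i \<in> GL d" and x: "x \<in> carrier_vec (n * d)"
  shows "diag_mat_family n (\<lambda>i. GL_inv d (F i)) *\<^sub>v (diag_mat_family n F *\<^sub>v x) = x"
    and "diag_mat_family n F *\<^sub>v (diag_mat_family n (\<lambda>i. GL_inv d (F i)) *\<^sub>v x) = x"
proof -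
  let ?D = "diag_mat_family n F" and ?E = "diag_mat_family n (\<lambda>i. GL_inv d (F i))"
  have Fc: "F i \<in> carrier_mat d d" "GL_inv d (F i) \<in> carrier_mat d d" if "i < n" for i
    using F that by (auto simp: GL_carrier GL_inv_carrier)
  have D: "?D \<in> carrier_mat (n * d) (n * d)" and E: "?E \<in> carrier_mat (n * d) (n * d)"
    using Fc by (auto intro: diag_mat_family_carrier)
  note Dx = mult_mat_vec_carrier[OF D x] and Ex = mult_mat_vec_carrier[OF E x]
  show "?E *\<^sub>v (?D *\<^sub>v x) = x"
    by (rule vec_eq_blockwise[OF mult_mat_vec_carrier[OF E Dx] x])
      (simp add: vec_block_diag_mat_family Fc x Dx GL_inv_mult_vec_cancel F)
  show "?D *\<^sub>v (?E *\<^sub>v x) = x"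
    by (rule vec_eq_blockwise[OF mult_mat_vec_carrier[OF D Ex] x])
      (simp add: vec_block_diag_mat_family Fc x Ex GL_inv_mult_vec_cancel F)
qed

lemma inj_on_diag_mat_family:
  assumes "\<forall>i<n. F i \<in> GL d"
  shows "inj_on (\<lambda>x. diag_mat_family n F *\<^sub>v x) (carrier_vec (n * d))"
  by (rule inj_on_inverseI[where g = "\<lambda>x. diag_mat_family n (\<lambda>i. GL_inv d (F i)) *\<^sub>v x"])
    (simp add: diag_mat_family_inverse(1)[OF assms])

section \<open>Factored edges imply condition (B)\<close>

text \<open>
  The relation \<open>(L \<otimes> I) D = D Z\<close>: on each edge \<open>G\<^sub>i G\<^sub>i\<^sub>j = G\<^sub>j\<close>, so applying \<open>G\<^sub>i\<close> to the
  disagreement \<open>x\<^sub>i - G\<^sub>i\<^sub>j x\<^sub>j\<close> gives the plain difference of the blocks \<open>i\<close> and \<open>j\<close> of \<open>D x\<close>.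
\<close>
lemma laplacian_diag_mat_family_intertwine:
  assumes F: "\<forall>i<n. F i \<in> GL d" and fac: "edges_factor d G B F"
    and E: "parcs G \<subseteq> {..<n} \<times> {..<n}" and x: "x \<in> carrier_vec (n * d)"
  shows "laplacian_mat n G \<otimes>\<^sub>K 1\<^sub>m d *\<^sub>v (diag_mat_family n F *\<^sub>v x)
    = diag_mat_family n F *\<^sub>v (Z_mat n d G B *\<^sub>v x)"
proof (rule vec_eq_blockwise[where n = n and d = d])
  let ?D = "diag_mat_family n F" and ?Z = "Z_mat n d G B" and ?I = "Z_mat n d G (\<lambda>_ _. 1\<^sub>m d)"
  have Fc: "F i \<in> carrier_mat d d" "GL_inv d (F i) \<in> carrier_mat d d" if "i < n" for i
    using F that by (auto simp: GL_carrier GL_inv_carrier)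
  have B: "B i j = GL_inv d (F i) * F j \<and> i < n \<and> j < n" if "(i, j) \<in> parcs G" for i j
    using fac E that by (auto simp: edges_factor_def)
  have Bc: "B i j \<in> carrier_mat d d" if "(i, j) \<in> parcs G" for i j
    using B[OF that] Fc(1)[of j] Fc(2)[of i] by (auto intro: mult_carrier_mat)
  have D: "?D \<in> carrier_mat (n * d) (n * d)" using Fc by (auto intro: diag_mat_family_carrier)
  note Dx = mult_mat_vec_carrier[OF D x] and Zx = mult_mat_vec_carrier[OF Z_mat_carrier x]
  show "laplacian_mat n G \<otimes>\<^sub>K 1\<^sub>m d *\<^sub>v (?D *\<^sub>v x) \<in> carrier_vec (n * d)"
    unfolding laplacian_kronecker_eq_Z_mat by (rule mult_mat_vec_carrier[OF Z_mat_carrier Dx])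
  show "?D *\<^sub>v (?Z *\<^sub>v x) \<in> carrier_vec (n * d)" by (rule mult_mat_vec_carrier[OF D Zx])
  fix i assume i: "i < n"
  let ?x = "vec_block d x"
  have FB: "F i *\<^sub>v (B i j *\<^sub>v ?x j) = F j *\<^sub>v ?x j" if "(i, j) \<in> parcs G" for j
  proof -
    have j: "j < n" using B[OF that] by simp
    have "F i *\<^sub>v (B i j *\<^sub>v ?x j) = F i *\<^sub>v (GL_inv d (F i) *\<^sub>v (F j *\<^sub>v ?x j))"
      using B[OF that] Fc[OF i] Fc[OF j] by (simp add: assoc_mult_mat_vec[of _ d d _ d])
    also have "\<dots> = F j *\<^sub>v ?x j"
      using F i Fc(1)[OF j] by (intro GL_inv_mult_vec_cancel(2)) auto
    finally show ?thesis .
  qed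
  show "vec_block d (laplacian_mat n G \<otimes>\<^sub>K 1\<^sub>m d *\<^sub>v (?D *\<^sub>v x)) i
      = vec_block d (?D *\<^sub>v (?Z *\<^sub>v x)) i"
  proof (rule eq_vecI)
    fix k assume "k < dim_vec (vec_block d (?D *\<^sub>v (?Z *\<^sub>v x)) i)"
    then have k: "k < d" by (simp add: vec_block_def)
    have Fik: "(F i *\<^sub>v v) $ k = (\<Sum>l\<in>{0..<d}. F i $$ (k, l) * v $ l)" if "v \<in> carrier_vec d" for v
      using Fc(1)[OF i] k that by (simp add: scalar_prod_def)
    have "vec_block d (?D *\<^sub>v (?Z *\<^sub>v x)) i $ k = (F i *\<^sub>v vec_block d (?Z *\<^sub>v x) i) $ k"
      using vec_block_diag_mat_family[OF Fc(1) Zx i] by simp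
    also have "\<dots> = (\<Sum>l\<in>{0..<d}. F i $$ (k, l) *
        (\<Sum>j<n. if (i, j) \<in> parcs G then ?x i $ l - (B i j *\<^sub>v ?x j) $ l else 0))"
      using vec_block_Z_mat[OF x i _ Bc] by (simp add: Fik)
    also have "\<dots> = (\<Sum>j<n. \<Sum>l\<in>{0..<d}. F i $$ (k, l) *
        (if (i, j) \<in> parcs G then ?x i $ l - (B i j *\<^sub>v ?x j) $ l else 0))"
      unfolding sum_distrib_left by (rule sum.swap)
    also have "\<dots> = (\<Sum>j<n. if (i, j) \<in> parcs G then (F i *\<^sub>v ?x i) $ k - (F j *\<^sub>v ?x j) $ k else 0)"
    proof (rule sum.cong[OF refl])
      fix j
      show "(\<Sum>l\<in>{0..<d}. F i $$ (k, l) *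
          (if (i, j) \<in> parcs G then ?x i $ l - (B i j *\<^sub>v ?x j) $ l else 0))
        = (if (i, j) \<in> parcs G then (F i *\<^sub>v ?x i) $ k - (F j *\<^sub>v ?x j) $ k else 0)"
      proof (cases "(i, j) \<in> parcs G")
        case True
        have "B i j *\<^sub>v ?x j \<in> carrier_vec d" using Bc[OF True] by simp
        then have "(F i *\<^sub>v (B i j *\<^sub>v ?x j)) $ k
            = (\<Sum>l\<in>{0..<d}. F i $$ (k, l) * (B i j *\<^sub>v ?x j) $ l)" by (rule Fik)
        then show ?thesis using True FB[OF True] Fik[of "?x i"]
          by (simp add: right_diff_distrib sum_subtractf)
      qed simp
    qed
    also have "\<dots> = (\<Sum>j<n. if (i, j) \<in> parcs G
        then vec_block d (?D *\<^sub>v x) i $ k - (1\<^sub>m d *\<^sub>v vec_block d (?D *\<^sub>v x) j) $ k else 0)"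
      unfolding one_mult_mat_vec[OF vec_block_carrier]
      using i by (intro sum.cong) (auto simp: vec_block_diag_mat_family[OF Fc(1) x])
    also have "\<dots> = vec_block d (?I *\<^sub>v (?D *\<^sub>v x)) i $ k"
      using vec_block_Z_mat[OF Dx i k, of G "\<lambda>_ _. 1\<^sub>m d"] by simp
    finally show "vec_block d (laplacian_mat n G \<otimes>\<^sub>K 1\<^sub>m d *\<^sub>v (?D *\<^sub>v x)) i $ k
        = vec_block d (?D *\<^sub>v (?Z *\<^sub>v x)) i $ k"
      by (simp add: laplacian_kronecker_eq_Z_mat)
  qed (simp add: vec_block_def)
qed

lemma edges_factor_imp_diag_maps_kernel:
  assumes F: "\<forall>i<n. F i \<in> GL d" and fac: "edges_factor d G B F"
    and E: "parcs G \<subseteq> {..<n} \<times> {..<n}"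
  shows "diag_maps_kernel n d G B F"
proof -
  let ?D = "diag_mat_family n F" and ?Z = "Z_mat n d G B" and ?L = "laplacian_mat n G \<otimes>\<^sub>K 1\<^sub>m d"
  let ?D' = "diag_mat_family n (\<lambda>i. GL_inv d (F i))"
  have Fc: "F i \<in> carrier_mat d d" "GL_inv d (F i) \<in> carrier_mat d d" if "i < n" for i
    using F that by (auto simp: GL_carrier GL_inv_carrier)
  have D: "?D \<in> carrier_mat (n * d) (n * d)" and D': "?D' \<in> carrier_mat (n * d) (n * d)"
    using Fc by (auto intro: diag_mat_family_carrier)
  have L: "?L \<in> carrier_mat (n * d) (n * d)" by (simp add: laplacian_kronecker_eq_Z_mat)
  have D0: "?D *\<^sub>v 0\<^sub>v (n * d) = 0\<^sub>v (n * d)" using D by auto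
  have "?D *\<^sub>v x \<in> mat_kernel ?L \<longleftrightarrow> x \<in> mat_kernel ?Z" if x: "x \<in> carrier_vec (n * d)" for x
  proof -
    note Zx = mult_mat_vec_carrier[OF Z_mat_carrier x]
    have "?D *\<^sub>v x \<in> mat_kernel ?L \<longleftrightarrow> ?D *\<^sub>v (?Z *\<^sub>v x) = ?D *\<^sub>v 0\<^sub>v (n * d)"
      using mat_kernel[OF L] mult_mat_vec_carrier[OF D x]
        laplacian_diag_mat_family_intertwine[OF F fac E x] D0 by simp
    also have "\<dots> \<longleftrightarrow> ?Z *\<^sub>v x = 0\<^sub>v (n * d)"
      using inj_on_diag_mat_family[OF F] Zx by (auto dest: inj_onD)
    also have "\<dots> \<longleftrightarrow> x \<in> mat_kernel ?Z"
      using mat_kernel[OF Z_mat_carrier] x by blast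
    finally show ?thesis .
  qed
  note iff = this
  have "(\<lambda>x. ?D *\<^sub>v x) ` mat_kernel ?Z = mat_kernel ?L"
  proof (intro equalityI subsetI)
    fix y assume "y \<in> (\<lambda>x. ?D *\<^sub>v x) ` mat_kernel ?Z"
    then show "y \<in> mat_kernel ?L" using iff mat_kernel_carrier[OF Z_mat_carrier] by blast
  next
    fix y assume y: "y \<in> mat_kernel ?L"
    then have yc: "y \<in> carrier_vec (n * d)" using mat_kernel_carrier[OF L] by blast
    have eq: "?D *\<^sub>v (?D' *\<^sub>v y) = y" by (rule diag_mat_family_inverse(2)[OF F yc])
    then have "?D' *\<^sub>v y \<in> mat_kernel ?Z"
      using iff[OF mult_mat_vec_carrier[OF D' yc]] y by simp
    then show "y \<in> (\<lambda>x. ?D *\<^sub>v x) ` mat_kernel ?Z" using eq by (metis imageI)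
  qed
  then show ?thesis using diag_maps_kernel_iff[of n F d G B] Fc by simp
qed

section \<open>The Laplacian kernel of a quasi-strongly connected graph\<close>

text \<open>
  Maximum principle: at a vertex where \<open>f\<close> attains its maximum, all differences \<open>f i - f j\<close> over
  outgoing edges are nonnegative and sum to zero, so \<open>f\<close> is also maximal at all out-neighbours.
  The maximum therefore propagates along a path from the maximizer to the center.
\<close>
lemma harmonic_le_center:
  fixes f :: "nat \<Rightarrow> real"
  assumes G: "digraph_on n G" and c: "is_center G c"
    and harm: "\<And>i. i < n \<Longrightarrow> (\<Sum>j<n. if (i, j) \<in> parcs G then f i - f j else 0) = 0"
    and v: "v < n"
  shows "f v \<le> f c"
proof -
  interpret pair_wf_digraph G using G by (simp add: digraph_on_def)
  have V: "pverts G = {..<n}" using G by (simp add: digraph_on_def)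
  have "\<exists>m<n. \<forall>i<n. f i \<le> f m"
    using v Max_in[of "f ` {..<n}"] Max_ge[of "f ` {..<n}"] by (fastforce simp: image_iff)
  then obtain m where m: "m < n" "\<And>i. i < n \<Longrightarrow> f i \<le> f m" by blast
  have "m \<rightarrow>\<^sup>*\<^bsub>with_proj G\<^esub> c"
  proof (cases "m = c")
    case False
    then obtain p where "apath m p c" using c m(1) V by (auto simp: is_center_def)
    then show ?thesis by (blast intro: reachable_awalkI awalkI_apath)
  qed (use m(1) V in auto)
  then have "f c = f m"
  proof (induction rule: reachable_induct)
    case (step x y)
    have xy: "(x, y) \<in> parcs G" "x < n" "y < n"
      using step(2) V adj_in_verts[OF step(2)] by auto
    have nn: "\<forall>j\<in>{..<n}. 0 \<le> (if (x, j) \<in> parcs G then f x - f j else 0)"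
      using m(2) step(3) by auto
    have "(if (x, y) \<in> parcs G then f x - f y else 0) = 0"
      using sum_nonneg_eq_0_iff[of "{..<n}" "\<lambda>j. if (x, j) \<in> parcs G then f x - f j else 0"]
        nn harm[OF xy(2)] xy(3) by simp
    then show ?case using xy(1) step(3) by simp
  qed simp
  then show ?thesis using m(2)[OF v] by simp
qed

text \<open>
  Harmonicity is preserved by negation, so the center also attains the minimum.
\<close>
lemma harmonic_constant:
  fixes f :: "nat \<Rightarrow> real"
  assumes G: "digraph_on n G" and c: "is_center G c"
    and harm: "\<And>i. i < n \<Longrightarrow> (\<Sum>j<n. if (i, j) \<in> parcs G then f i - f j else 0) = 0"
    and v: "v < n"
  shows "f v = f c"
proof (rule antisym)
  show "f v \<le> f c" by (rule harmonic_le_center[OF assms])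
  have "(\<Sum>j<n. if (i, j) \<in> parcs G then - f i - - f j else 0) = 0" if "i < n" for i
  proof -
    have "(\<Sum>j<n. if (i, j) \<in> parcs G then - f i - - f j else 0)
        = - (\<Sum>j<n. if (i, j) \<in> parcs G then f i - f j else 0)"
      unfolding sum_negf[symmetric] by (intro sum.cong) auto
    then show ?thesis using harm[OF that] by simp
  qed
  from harmonic_le_center[OF G c this v] show "f c \<le> f v" by simp
qed

text \<open>
  The equation \<open>(L \<otimes> I) x = 0\<close> decouples into \<open>d\<close> scalar ones: for each \<open>k\<close>, the \<open>k\<close>-th entries of
  the blocks form a harmonic function on the vertices.
\<close>
lemma laplacian_kernel_consensus:
  assumes G: "digraph_on n G" and c: "is_center G c"
  shows "mat_kernel (laplacian_mat n G \<otimes>\<^sub>K 1\<^sub>m d)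
    = {x \<in> carrier_vec (n * d). \<forall>i<n. vec_block d x i = vec_block d x c}"
proof -
  let ?L = "Z_mat n d G (\<lambda>_ _. 1\<^sub>m d)"
  have cn: "c < n" using G c by (auto simp: digraph_on_def is_center_def)
  have Lx: "vec_block d (?L *\<^sub>v x) i $ k
      = (\<Sum>j<n. if (i, j) \<in> parcs G then vec_block d x i $ k - vec_block d x j $ k else 0)"
    if "x \<in> carrier_vec (n * d)" "i < n" "k < d" for x i k
    unfolding vec_block_Z_mat[OF that, of G "\<lambda>_ _. 1\<^sub>m d", OF one_carrier_mat]
      one_mult_mat_vec[OF vec_block_carrier] ..
  have "?L *\<^sub>v x = 0\<^sub>v (n * d) \<longleftrightarrow> (\<forall>i<n. vec_block d x i = vec_block d x c)"
    if x: "x \<in> carrier_vec (n * d)" for x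
  proof
    assume 0: "?L *\<^sub>v x = 0\<^sub>v (n * d)"
    show "\<forall>i<n. vec_block d x i = vec_block d x c"
    proof (intro allI impI eq_vecI)
      fix i k assume i: "i < n" and "k < dim_vec (vec_block d x c)"
      then have k: "k < d" by (simp add: vec_block_def)
      show "vec_block d x i $ k = vec_block d x c $ k"
        using Lx[OF x _ k] 0 k
        by (intro harmonic_constant[OF G c _ i, where f = "\<lambda>i. vec_block d x i $ k"])
          (simp add: vec_block_zero)
    qed (simp add: vec_block_def)
  next
    assume eq: "\<forall>i<n. vec_block d x i = vec_block d x c"
    show "?L *\<^sub>v x = 0\<^sub>v (n * d)"
    proof (rule vec_eq_blockwise[where n = n and d = d])
      fix i assume i: "i < n"
      show "vec_block d (?L *\<^sub>v x) i = vec_block d (0\<^sub>v (n * d)) i"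
      proof (rule eq_vecI)
        fix k assume "k < dim_vec (vec_block d (0\<^sub>v (n * d)) i)"
        then have k: "k < d" by (simp add: vec_block_def)
        show "vec_block d (?L *\<^sub>v x) i $ k = vec_block d (0\<^sub>v (n * d)) i $ k"
          unfolding Lx[OF x i k] vec_block_zero[OF i] using eq i k
          by (auto intro!: sum.neutral)
      qed (simp add: vec_block_def)
    qed (use mult_mat_vec_carrier[OF Z_mat_carrier x] in auto)
  qed
  then show ?thesis
    unfolding laplacian_kronecker_eq_Z_mat mat_kernel[OF Z_mat_carrier] by blast
qed

section \<open>Condition (B) and the image of the stacked inverses\<close>
lemma U1_mat_carrier: "U1_mat n d F \<in> carrier_mat (n * d) d"
  using block_mat_carrier[of n 1 d] by (simp add: U1_mat_def)

lemma vec_block_U1_mat: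
  assumes F: "\<forall>i<n. F i \<in> GL d" and v: "v \<in> carrier_vec d" and i: "i < n"
  shows "vec_block d (U1_mat n d F *\<^sub>v v) i = GL_inv d (F i) *\<^sub>v v"
proof (rule eq_vecI)
  have Fi: "GL_inv d (F i) \<in> carrier_mat d d" using F i by (simp add: GL_inv_carrier)
  show "dim_vec (vec_block d (U1_mat n d F *\<^sub>v v) i) = dim_vec (GL_inv d (F i) *\<^sub>v v)"
    using Fi by (simp add: vec_block_def)
  have v0: "vec_block d v 0 = v" using v by (auto simp: vec_block_def)
  fix k assume "k < dim_vec (GL_inv d (F i) *\<^sub>v v)"
  then show "vec_block d (U1_mat n d F *\<^sub>v v) i $ k = (GL_inv d (F i) *\<^sub>v v) $ k"
    unfolding U1_mat_def using Fi v i v0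
    by (subst vec_block_block_mat_mult) auto
qed

text \<open>
  In this form the image can be compared with the set of vectors whose blocks are all equal, and the
  images for two families can be compared with each other.
\<close>
lemma mat_image_U1_mat:
  assumes F: "\<forall>i<n. F i \<in> GL d"
  shows "mat_image (U1_mat n d F) = {x \<in> carrier_vec (n * d).
    \<exists>v\<in>carrier_vec d. \<forall>i<n. vec_block d x i = GL_inv d (F i) *\<^sub>v v}"
proof -
  have dims: "dim_col (U1_mat n d F) = d" using U1_mat_carrier[of n d F] by simp
  have "x = U1_mat n d F *\<^sub>v v \<longleftrightarrow>
      x \<in> carrier_vec (n * d) \<and> (\<forall>i<n. vec_block d x i = GL_inv d (F i) *\<^sub>v v)"
    if v: "v \<in> carrier_vec d" for x v
    using mult_mat_vec_carrier[OF U1_mat_carrier v, of n F] vec_block_U1_mat[OF F v]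
    by (auto intro: vec_eq_blockwise)
  then show ?thesis unfolding mat_image_def dims image_def by blast
qed

text \<open>
  Block \<open>i\<close> of \<open>D (U\<^sub>1 v)\<close> is \<open>G\<^sub>i G\<^sub>i\<inverse> v = v\<close>, for every \<open>i\<close>.
\<close>
lemma diag_image_U1_eq_consensus:
  assumes F: "\<forall>i<n. F i \<in> GL d" and c: "c < n"
  shows "(\<lambda>x. diag_mat_family n F *\<^sub>v x) ` mat_image (U1_mat n d F)
    = {x \<in> carrier_vec (n * d). \<forall>i<n. vec_block d x i = vec_block d x c}"
    (is "?D ` ?U = ?C")
proof (intro equalityI subsetI)
  have Fc: "F i \<in> carrier_mat d d" "GL_inv d (F i) \<in> carrier_mat d d" if "i < n" for i
    using F that by (auto simp: GL_carrier GL_inv_carrier)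
  have D: "diag_mat_family n F \<in> carrier_mat (n * d) (n * d)"
    and D': "diag_mat_family n (\<lambda>i. GL_inv d (F i)) \<in> carrier_mat (n * d) (n * d)"
    using Fc by (auto intro: diag_mat_family_carrier)
  {
    fix y assume "y \<in> ?D ` ?U"
    then obtain x v where x: "x \<in> carrier_vec (n * d)" and y: "y = ?D x" and v: "v \<in> carrier_vec d"
      and eq: "\<And>i. i < n \<Longrightarrow> vec_block d x i = GL_inv d (F i) *\<^sub>v v"
      unfolding mat_image_U1_mat[OF F] by auto
    have "vec_block d y i = v" if i: "i < n" for i
      using i F eq[OF i] v by (simp add: y vec_block_diag_mat_family[OF Fc(1) x] GL_inv_mult_vec_cancel)
    then show "y \<in> ?C" using c mult_mat_vec_carrier[OF D x] y by simp
  next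
    fix y assume "y \<in> ?C"
    then have y: "y \<in> carrier_vec (n * d)" and eq: "\<And>i. i < n \<Longrightarrow> vec_block d y i = vec_block d y c"
      by auto
    let ?x = "diag_mat_family n (\<lambda>i. GL_inv d (F i)) *\<^sub>v y"
    have "vec_block d ?x i = GL_inv d (F i) *\<^sub>v vec_block d y c" if "i < n" for i
      using vec_block_diag_mat_family[where F = "\<lambda>i. GL_inv d (F i)", OF Fc(2) y that] eq[OF that]
      by simp
    then have "?x \<in> ?U"
      unfolding mat_image_U1_mat[OF F] using mult_mat_vec_carrier[OF D' y] vec_block_carrier by blast
    then show "y \<in> ?D ` ?U" using diag_mat_family_inverse(2)[OF F y] by (metis imageI)
  }
qed

lemma diag_maps_kernel_iff_image_U1:
  assumes G: "digraph_on n G" and c: "is_center G c" and F: "\<forall>i<n. F i \<in> GL d"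
  shows "diag_maps_kernel n d G B F \<longleftrightarrow> mat_image (U1_mat n d F) = mat_kernel (Z_mat n d G B)"
proof -
  have cn: "c < n" using G c by (auto simp: digraph_on_def is_center_def)
  have "diag_maps_kernel n d G B F \<longleftrightarrow>
      (\<lambda>x. diag_mat_family n F *\<^sub>v x) ` mat_kernel (Z_mat n d G B)
        = (\<lambda>x. diag_mat_family n F *\<^sub>v x) ` mat_image (U1_mat n d F)"
    using F by (subst diag_maps_kernel_iff)
      (auto simp: GL_carrier laplacian_kernel_consensus[OF G c] diag_image_U1_eq_consensus[OF F cn])
  also have "\<dots> \<longleftrightarrow> mat_kernel (Z_mat n d G B) = mat_image (U1_mat n d F)"
    by (rule inj_on_image_eq_iff[OF inj_on_diag_mat_family[OF F]])
      (auto simp: mat_image_U1_mat[OF F] intro: subsetD[OF mat_kernel_carrier[OF Z_mat_carrier]])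
  finally show ?thesis by auto
qed

section \<open>Recovering the edge factorization\<close>

text \<open>
  For each \<open>v\<close> there is a \<open>w\<close> with \<open>F\<^sub>i\<inverse> v = K\<^sub>i\<inverse> w\<close> for all \<open>i\<close>, that is, \<open>K\<^sub>i F\<^sub>i\<inverse> v = w\<close>. So the
  matrices \<open>K\<^sub>i F\<^sub>i\<inverse>\<close> agree on every vector and do not depend on \<open>i\<close>; multiplying
  \<open>K\<^sub>i F\<^sub>i\<inverse> = K\<^sub>j F\<^sub>j\<inverse>\<close> by \<open>K\<^sub>i\<inverse>\<close> on the left and by \<open>F\<^sub>j\<close> on the right gives the claim.
\<close>
lemma image_U1_eq_imp_same_quotients:
  assumes F: "\<forall>i<n. F i \<in> GL d" and K: "\<forall>i<n. K i \<in> GL d"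
    and sub: "mat_image (U1_mat n d F) \<subseteq> mat_image (U1_mat n d K)"
    and i: "i < n" and j: "j < n"
  shows "GL_inv d (F i) * F j = GL_inv d (K i) * K j"
proof -
  have Fc: "F i \<in> carrier_mat d d" "GL_inv d (F i) \<in> carrier_mat d d" if "i < n" for i
    using F that by (auto simp: GL_carrier GL_inv_carrier)
  have Kc: "K i \<in> carrier_mat d d" "GL_inv d (K i) \<in> carrier_mat d d" if "i < n" for i
    using K that by (auto simp: GL_carrier GL_inv_carrier)
  have "K i * GL_inv d (F i) = K j * GL_inv d (F j)"
  proof (rule mat_eq_by_action[where m = d and n = d])
    fix v :: "real vec" assume v: "v \<in> carrier_vec d"
    have "U1_mat n d F *\<^sub>v v \<in> mat_image (U1_mat n d K)"
      using sub v U1_mat_carrier[of n d F] by (auto simp: mat_image_def)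
    then obtain w where w: "w \<in> carrier_vec d"
      and "\<And>i. i < n \<Longrightarrow> vec_block d (U1_mat n d F *\<^sub>v v) i = GL_inv d (K i) *\<^sub>v w"
      unfolding mat_image_U1_mat[OF K] by auto
    then have eq: "GL_inv d (F i) *\<^sub>v v = GL_inv d (K i) *\<^sub>v w" if "i < n" for i
      using vec_block_U1_mat[OF F v that] that by simp
    have "(K i * GL_inv d (F i)) *\<^sub>v v = w" if "i < n" for i
      using that K w v eq[OF that] Kc[OF that] Fc[OF that]
      by (simp add: assoc_mult_mat_vec[of _ d d _ d] GL_inv_mult_vec_cancel)
    then show "(K i * GL_inv d (F i)) *\<^sub>v v = (K j * GL_inv d (F j)) *\<^sub>v v"
      using i j by simp
  next
    show "K i * GL_inv d (F i) \<in> carrier_mat d d" by (rule mult_carrier_mat[OF Kc(1)[OF i] Fc(2)[OF i]])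
    show "K j * GL_inv d (F j) \<in> carrier_mat d d" by (rule mult_carrier_mat[OF Kc(1)[OF j] Fc(2)[OF j]])
  qed
  then have "GL_inv d (K i) * (K i * GL_inv d (F i)) * F j = GL_inv d (K i) * (K j * GL_inv d (F j)) * F j"
    by simp
  moreover have "GL_inv d (K i) * (K i * GL_inv d (F i)) * F j = GL_inv d (F i) * F j"
    using Kc[OF i] Fc[OF i] GL_inv_left[of "K i" d] K i
    by (simp flip: assoc_mult_mat[of _ d d _ d _ d])
  moreover have "GL_inv d (K i) * (K j * GL_inv d (F j)) * F j = GL_inv d (K i) * K j"
    using Kc[OF i] Kc[OF j] Fc[OF j] GL_inv_left[of "F j" d] F j
    by (simp add: assoc_mult_mat[of _ d d _ d _ d])
  ultimately show ?thesis by simp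
qed

text \<open>
  Fix a vertex \<open>c\<close> and take \<open>K\<^sub>i = H\<^sub>c\<^sub>i\<close> for the extension \<open>H\<close> to the complete graph; then
  \<open>H\<^sub>c\<^sub>j = H\<^sub>c\<^sub>i H\<^sub>i\<^sub>j\<close> reads \<open>H\<^sub>i\<^sub>j = K\<^sub>i\<inverse> K\<^sub>j\<close>.
\<close>
lemma transitively_consistent_factors:
  assumes tc: "transitively_consistent n d G B" and E: "parcs G \<subseteq> {..<n} \<times> {..<n}" and c: "c < n"
  shows "\<exists>K. (\<forall>i<n. K i \<in> GL d) \<and> edges_factor d G B K"
proof -
  obtain H where complete: "transitively_consistent_complete n d H"
    and ext: "\<forall>(i, j) \<in> parcs G. H i j = B i j"
    using tc unfolding transitively_consistent_def by (elim conjE exE)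
  have H: "H i j \<in> GL d" if "i < n" "j < n" for i j
    using complete[unfolded transitively_consistent_complete_def, THEN conjunct1] that by blast
  have trans: "H i k = H i j * H j k" if "i < n" "j < n" "k < n" for i j k
    by (rule complete[unfolded transitively_consistent_complete_def, THEN conjunct2, rule_format])
      (rule that)+
  have "H i j = GL_inv d (H c i) * H c j" if "i < n" "j < n" for i j
  proof -
    have Hci: "H c i \<in> GL d" and Hij: "H i j \<in> GL d" using H c that by auto
    have "GL_inv d (H c i) * H c j = GL_inv d (H c i) * (H c i * H i j)"
      by (rule arg_cong[OF trans[OF c that]])
    also have "\<dots> = GL_inv d (H c i) * H c i * H i j"
      by (rule assoc_mult_mat[symmetric, OF GL_inv_carrier[OF Hci] GL_carrier[OF Hci] GL_carrier[OF Hij]])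
    also have "\<dots> = H i j"
      unfolding GL_inv_left[OF Hci] by (rule left_mult_one_mat[OF GL_carrier[OF Hij]])
    finally show ?thesis by simp
  qed
  then have "H i j = GL_inv d (H c i) * H c j" if "(i, j) \<in> parcs G" for i j
    using E that by auto
  then have "edges_factor d G B (H c)"
    using ext unfolding edges_factor_def by fastforce
  moreover have "\<forall>i<n. H c i \<in> GL d" using H[OF c] by blast
  ultimately show ?thesis by blast
qed

section \<open>The equivalence\<close>
theorem lemma8:
  fixes n d :: nat
    and G :: "nat pair_pre_digraph"
    and Gij :: "nat \<Rightarrow> nat \<Rightarrow> real mat"
    and Gi :: "nat \<Rightarrow> real mat"
  assumes "digraph_on n G"
    and "transitively_consistent n d G Gij"
    and "\<forall>i<n. Gi i \<in> GL d"
  shows "(edges_factor d G Gij Gi \<longrightarrow> diag_maps_kernel n d G Gij Gi) \<and>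
    (quasi_strongly_connected G \<longrightarrow>
       (edges_factor d G Gij Gi \<longleftrightarrow> diag_maps_kernel n d G Gij Gi) \<and>
       (diag_maps_kernel n d G Gij Gi \<longleftrightarrow>
          mat_image (U1_mat n d Gi) = mat_kernel (Z_mat n d G Gij)))"
proof -
  interpret pair_wf_digraph G using assms(1) by (simp add: digraph_on_def)
  have V: "pverts G = {..<n}" using assms(1) by (simp add: digraph_on_def)
  have E: "parcs G \<subseteq> {..<n} \<times> {..<n}"
    using arc_fst_in_verts arc_snd_in_verts V by fastforce
  have AB: "edges_factor d G Gij Gi \<Longrightarrow> diag_maps_kernel n d G Gij Gi"
    by (rule edges_factor_imp_diag_maps_kernel[OF assms(3) _ E])
  moreover have "edges_factor d G Gij Gi" if qsc: "quasi_strongly_connected G"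
    and B: "diag_maps_kernel n d G Gij Gi"
  proof -
    obtain c where c: "is_center G c" using qsc by (auto simp: quasi_strongly_connected_def)
    then have cn: "c < n" using V by (simp add: is_center_def)
    obtain K where K: "\<forall>i<n. K i \<in> GL d" and KE: "edges_factor d G Gij K"
      using transitively_consistent_factors[OF assms(2) E cn] by blast
    have "mat_image (U1_mat n d Gi) = mat_kernel (Z_mat n d G Gij)"
      using B diag_maps_kernel_iff_image_U1[OF assms(1) c assms(3)] by blast
    also have "\<dots> = mat_image (U1_mat n d K)"
      using edges_factor_imp_diag_maps_kernel[OF K KE E]
        diag_maps_kernel_iff_image_U1[OF assms(1) c K] by blast
    finally have "\<And>i j. i < n \<Longrightarrow> j < n \<Longrightarrow> GL_inv d (Gi i) * Gi j = GL_inv d (K i) * K j"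
      by (intro image_U1_eq_imp_same_quotients[OF assms(3) K]) auto
    then have "GL_inv d (Gi i) * Gi j = GL_inv d (K i) * K j" if "(i, j) \<in> parcs G" for i j
      using E that by blast
    then show ?thesis using KE unfolding edges_factor_def by auto
  qed
  ultimately show ?thesis
    using diag_maps_kernel_iff_image_U1[OF assms(1) _ assms(3)]
    unfolding quasi_strongly_connected_def by blast
qed

end
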